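(* Let $d\geq 2$ and let $f:[0,4]\to(-\infty,\infty]$ be finite, non-increasing, and convex on $(0,4]$, differentiable in $(0,4)$ with a concave derivative $f'$ on $(0,4)$, and such that $\lim_{t\to 0^+}f(t)=f(0)$. Let $\omega_d^\ast$ be the set of vertices of a regular $d$-simplex inscribed in $S^{d-1}$. Then $$P_f(\omega_d,S^{d-1})\leq P_f(\omega_d^\ast,S^{d-1})\qquad(\ast)$$ for every $(d+1)$-point configuration $\omega_d\subset S^{d-1}$. Furthermore, $$\mathcal P_f(S^{d-1})=P_f(\omega_d^\ast,S^{d-1})=f(4)+d\cdot f\left(2-\frac{2}{d}\right).$$ If the convexity of $f$ is strict on $(0,4]$, then equality in $(\ast)$ holds if and only if $\omega_d$ is the set of vertices of a regular $d$-simplex inscribed in $S^{d-1}$.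
   Context: $S^{d-1}=\{\mathbf x\in\mathbb R^d: |\mathbf x|=1\}$, where $|\cdot|$ is the Euclidean norm. A $(d+1)$-point configuration on $S^{d-1}$ is a set $\omega_d=\{\mathbf v_0,\ldots,\mathbf v_d\}\subset S^{d-1}$ of cardinality $d+1$. The vertices of a regular $d$-simplex inscribed in $S^{d-1}$ are $d+1$ points of $S^{d-1}$ whose pairwise distances are all equal (equivalently, distinct vertices have inner product $-1/d$). For a function $f:[0,4]\to(-\infty,\infty]$ define $$p_f(\mathbf x,\omega_d)=\sum_{i=0}^{d} f(|\mathbf x-\mathbf v_i|^2),\ \ \mathbf x\in S^{d-1},\qquad P_f(\omega_d,S^{d-1})=\min_{\mathbf x\in S^{d-1}}p_f(\mathbf x,\omega_d),$$ $$\mathcal P_f(S^{d-1})=\sup\{P_f(\omega_d,S^{d-1}):\omega_d\subset S^{d-1},\ \#\omega_d=d+1\}.$$ The limit at $0$ is understood in the extended sense (the value $f(0)=\infty$ is allowed). *)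

theory Defs
  imports "HOL-Analysis.Analysis"
begin

text \<open>
  A function \<open>f : [0,4] \<rightarrow> (-\<infinity>,\<infinity>]\<close> is modelled by a total function \<open>real \<Rightarrow> ereal\<close>; only its values
  on \<open>{0..4}\<close> matter. The space \<open>\<real>\<^sup>d\<close> is \<open>real ^ 'n\<close> with \<open>d = CARD('n)\<close>.
\<close>

definition potential :: "(real \<Rightarrow> ereal) \<Rightarrow> (real ^ 'n) set \<Rightarrow> real ^ 'n \<Rightarrow> ereal"
  where "potential f \<omega> x = (\<Sum>v\<in>\<omega>. f ((norm (x - v))\<^sup>2))"

text \<open>
  \<open>polarization f \<omega> A\<close> is the minimum of the potential over \<open>A\<close>. \<open>LEAST\<close> selects the smallest element
  of the set of values and is unspecified if there is none, so nothing can be concluded about it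
  without showing that the minimum is attained.
\<close>

definition polarization :: "(real \<Rightarrow> ereal) \<Rightarrow> (real ^ 'n) set \<Rightarrow> (real ^ 'n) set \<Rightarrow> ereal"
  where "polarization f \<omega> A = (LEAST y. y \<in> potential f \<omega> ` A)"

definition configuration :: "(real ^ 'n) set \<Rightarrow> bool"
  where "configuration \<omega> \<longleftrightarrow> \<omega> \<subseteq> sphere 0 1 \<and> card \<omega> = CARD('n) + 1"

definition max_polarization :: "(real \<Rightarrow> ereal) \<Rightarrow> (real ^ 'n) set \<Rightarrow> ereal"
  where "max_polarization f A = (SUP \<omega>\<in>{\<omega>. \<omega> \<subseteq> A \<and> card \<omega> = CARD('n) + 1}. polarization f \<omega> A)"

definition regular_simplex_vertices :: "(real ^ 'n) set \<Rightarrow> bool"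
  where "regular_simplex_vertices \<omega> \<longleftrightarrow>
    configuration \<omega> \<and> (\<exists>r. \<forall>v\<in>\<omega>. \<forall>w\<in>\<omega>. v \<noteq> w \<longrightarrow> dist v w = r)"

definition strictly_convex_on :: "real set \<Rightarrow> (real \<Rightarrow> real) \<Rightarrow> bool"
  where "strictly_convex_on S g \<longleftrightarrow> convex S \<and>
    (\<forall>x\<in>S. \<forall>y\<in>S. \<forall>u>0. \<forall>v>0. x \<noteq> y \<longrightarrow> u + v = 1 \<longrightarrow>
       g (u * x + v * y) < u * g x + v * g y)"

text \<open>
  Convexity and differentiability are expressed through the real-valued function
  \<open>real_of_ereal \<circ> f\<close>, which agrees with \<open>f\<close> on \<open>{0<..4}\<close> by the finiteness assumption.
\<close>

definition admissible_potential :: "(real \<Rightarrow> ereal) \<Rightarrow> bool"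
  where "admissible_potential f \<longleftrightarrow>
    (\<forall>t\<in>{0..4}. f t \<noteq> -\<infinity>) \<and>
    (\<forall>t\<in>{0<..4}. f t \<noteq> \<infinity>) \<and>
    antimono_on {0<..4} f \<and>
    convex_on {0<..4} (real_of_ereal \<circ> f) \<and>
    (\<forall>t\<in>{0<..<4}. (real_of_ereal \<circ> f) differentiable (at t)) \<and>
    concave_on {0<..<4} (deriv (real_of_ereal \<circ> f)) \<and>
    (f \<longlongrightarrow> f 0) (at_right 0)"

end

theory Submission
  imports Defs
begin

text \<open>
  Write \<open>d = CARD('n)\<close> and \<open>F = real_of_ereal \<circ> f\<close>. For unit vectors \<open>|x - v|\<^sup>2 = 2 - 2 (x \<bullet> v)\<close>, so a
  potential depends only on the inner products \<open>x \<bullet> v\<close>. The common bound for all configurations is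
  \<open>M = d F(2 - 2/d) + F 4\<close>, the potential of the regular simplex at the antipode of a vertex \<open>v\<close>,
  where one inner product is \<open>-1\<close> and the others are \<open>1/d\<close>.

  \<^emph>\<open>The regular simplex has polarization \<open>M\<close>.\<close> The vertices form a tight frame centred at \<open>0\<close>: for
  unit \<open>x\<close> the sums of \<open>x \<bullet> v\<close> and of \<open>(x \<bullet> v)\<^sup>2\<close> over the vertices do not depend on \<open>x\<close>
  (\<open>regular_simplex_sum_eq_0\<close>, \<open>regular_simplex_sum_inner_squares\<close>). Hence the potential of any
  quadratic polynomial is constant on the sphere. Concavity of \<open>F'\<close> says that the third derivative
  of \<open>F\<close> is nonpositive in the weak sense, so the quadratic that agrees with \<open>F\<close> at \<open>4\<close> and to
  first order at \<open>2 - 2/d\<close> lies below \<open>F\<close> (\<open>hermite_quadratic_minorant\<close>). Its constant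
  potential is therefore a lower bound, and it equals \<open>M\<close> because the antipode of a vertex only sees
  the two interpolation nodes.

  \<^emph>\<open>No configuration has larger polarization.\<close> It suffices to find one unit vector \<open>x\<close>, one point \<open>v\<close>
  and a number \<open>0 \<le> h \<le> 1/d\<close> such that \<open>x \<bullet> v \<le> - d h\<close> and \<open>x \<bullet> w \<le> h\<close> for the other points
  (\<open>separating_direction\<close>): monotonicity then bounds the potential at \<open>x\<close> by
  \<open>d F(2 - 2h) + F(2 + 2dh)\<close>. The arguments \<open>2 - 2h\<close> and \<open>2 + 2dh\<close> have the weighted mean \<open>2\<close>
  with weights \<open>d\<close> and \<open>1\<close> for every \<open>h\<close>, and they spread out as \<open>h\<close> grows, so by convexity the
  bound is at most its value \<open>M\<close> at \<open>h = 1/d\<close> (\<open>weighted_values_le\<close>).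

  If the configuration lies in a closed half-space \<open>{v. x \<bullet> v \<le> 0}\<close>, that \<open>x\<close> with \<open>h = 0\<close> works.
  Otherwise the points span a simplex with \<open>0\<close> in its interior. The unit outer normal of the facet
  opposite to \<open>v\<close>, at distance \<open>h\<close> from \<open>0\<close>, has inner product \<open>h\<close> with the points of the facet
  and \<open>- k h\<close> with \<open>v\<close>, where \<open>1 / (1 + k)\<close> is the barycentric coordinate of \<open>0\<close> at \<open>v\<close>. These
  \<open>d + 1\<close> coordinates sum to \<open>1\<close>, so one of them is at most \<open>1 / (d + 1)\<close>, which means \<open>k \<ge> d\<close>;
  and \<open>k h \<le> 1\<close> since \<open>v\<close> is a unit vector.

  \<^emph>\<open>Equality.\<close> Under strict convexity, equality forces \<open>h = 1/d\<close> for every facet with \<open>k \<ge> d\<close>. Then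
  \<open>k = d\<close> there, hence \<open>k \<le> d\<close> throughout, hence \<open>k = d\<close> throughout because the coordinates sum
  to \<open>1\<close>. Every facet normal is then \<open>- v\<close>, and all mutual inner products are \<open>- 1/d\<close>.
\<close>

section \<open>Directions that separate a configuration\<close>

text \<open>
  If no half-space through \<open>0\<close> contains \<open>\<omega>\<close>, deleting any point \<open>v\<close> must leave a basis, since a vector
  orthogonal to the remaining points would give such a half-space after a change of sign. The hyperplane
  through these \<open>d\<close> points is then \<open>{w. y v \<bullet> w = 1}\<close> for a unique \<open>y v\<close>, at distance \<open>1 / |y v|\<close>
  from \<open>0\<close>. Pairing a linear dependence \<open>\<Sum>w. c w w = 0\<close> with \<open>y v\<close> shows that \<open>c v\<close> is proportional
  to \<open>1 / (1 + k v)\<close>, so these numbers are the barycentric coordinates of \<open>0\<close>.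
\<close>
lemma halfspace_or_facet_normals:
  fixes \<omega> :: "'a::euclidean_space set"
  assumes card: "card \<omega> = DIM('a) + 1"
  obtains (halfspace) x where "norm x = 1" "\<And>v. v \<in> \<omega> \<Longrightarrow> x \<bullet> v \<le> 0"
  | (facets) y k where
      "\<And>v. v \<in> \<omega> \<Longrightarrow> k v > 0"
      "\<And>v. v \<in> \<omega> \<Longrightarrow> y v \<bullet> v = - k v"
      "\<And>v w. v \<in> \<omega> \<Longrightarrow> w \<in> \<omega> \<Longrightarrow> w \<noteq> v \<Longrightarrow> y v \<bullet> w = 1"
      "(\<Sum>v\<in>\<omega>. 1 / (1 + k v)) = 1"
proof (cases "\<exists>x. x \<noteq> 0 \<and> (\<forall>v\<in>\<omega>. x \<bullet> v \<le> 0)")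
  case True
  then obtain x where x: "x \<noteq> 0" "\<forall>v\<in>\<omega>. x \<bullet> v \<le> 0" by blast
  show thesis
  proof (rule halfspace)
    show "norm (x /\<^sub>R norm x) = 1" using x by simp
    show "(x /\<^sub>R norm x) \<bullet> v \<le> 0" if "v \<in> \<omega>" for v
      using x that by (simp add: mult_le_0_iff)
  qed
next
  case False
  then have no_halfspace: "x = 0" if "\<And>v. v \<in> \<omega> \<Longrightarrow> x \<bullet> v \<le> 0" for x
    using that by blast
  have fin: "finite \<omega>"
    using card by (intro card_ge_0_finite) simp
  have card1: "card (\<omega> - {v}) = DIM('a)" if "v \<in> \<omega>" for v
    using card that fin by simp
  have spans: "span (\<omega> - {v}) = UNIV" if v: "v \<in> \<omega>" for v
  proof (rule ccontr)
    assume "span (\<omega> - {v}) \<noteq> UNIV"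
    then obtain a where a: "a \<noteq> 0" "span (\<omega> - {v}) \<subseteq> {x. a \<bullet> x = 0}"
      using span_not_univ_subset_hyperplane by blast
    define s :: real where "s = (if a \<bullet> v \<le> 0 then 1 else -1)"
    have "(s *\<^sub>R a) \<bullet> w \<le> 0" if "w \<in> \<omega>" for w
    proof (cases "w = v")
      case False
      then have "w \<in> span (\<omega> - {v})" using that by (simp add: span_base)
      then show ?thesis using a by auto
    qed (simp add: s_def)
    then have "s *\<^sub>R a = 0" by (rule no_halfspace)
    then show False using a by (simp add: s_def split: if_splits)
  qed
  have indep: "independent (\<omega> - {v})" if v: "v \<in> \<omega>" for v
    by (rule card_le_dim_spanning[of _ UNIV]) (use spans[OF v] card1[OF v] fin in auto)
  have "\<exists>y. \<forall>w\<in>\<omega> - {v}. y \<bullet> w = 1" if v: "v \<in> \<omega>" for v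
  proof -
    obtain g :: "'a \<Rightarrow> real" where g: "linear g" "\<forall>w\<in>\<omega> - {v}. g w = 1"
      using linear_independent_extend[OF indep[OF v], of "\<lambda>_. 1"] by auto
    have "adjoint g 1 \<bullet> w = g w" for w
      using adjoint_works[OF g(1), of w 1] by (simp add: inner_commute)
    then show ?thesis using g(2) by metis
  qed
  then obtain y where "\<forall>v\<in>\<omega>. \<forall>w\<in>\<omega> - {v}. y v \<bullet> w = 1"
    using bchoice[of \<omega> "\<lambda>v y. \<forall>w\<in>\<omega> - {v}. y \<bullet> w = 1"] by blast
  then have y: "y v \<bullet> w = 1" if "v \<in> \<omega>" "w \<in> \<omega>" "w \<noteq> v" for v w
    using that by blast
  define k where "k v = - (y v \<bullet> v)" for v
  have k_pos: "k v > 0" if v: "v \<in> \<omega>" for v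
  proof (rule ccontr)
    assume "\<not> k v > 0"
    then have "- y v \<bullet> w \<le> 0" if "w \<in> \<omega>" for w
      using y[OF v that] by (cases "w = v") (auto simp: k_def)
    then have "- y v = 0" by (rule no_halfspace)
    moreover have "card (\<omega> - {v}) \<noteq> 0" using card1[OF v] by simp
    then have "\<omega> - {v} \<noteq> {}" by (metis card.empty)
    then obtain w where "w \<in> \<omega>" "w \<noteq> v" by blast
    then have "y v \<bullet> w = 1" by (rule y[OF v])
    ultimately show False by simp
  qed
  have "dependent \<omega>" using card by (intro dependent_biggerset) simp
  then obtain c where c: "(\<Sum>w\<in>\<omega>. c w *\<^sub>R w) = 0" and c_nz: "\<exists>v\<in>\<omega>. c v \<noteq> 0"
    unfolding dependent_finite[OF fin] by blast
  define S where "S = (\<Sum>w\<in>\<omega>. c w)"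
  have S: "S = c v * (1 + k v)" if v: "v \<in> \<omega>" for v
  proof -
    have "0 = y v \<bullet> (\<Sum>w\<in>\<omega>. c w *\<^sub>R w)" using c by simp
    also have "\<dots> = (\<Sum>w\<in>\<omega>. c w * (y v \<bullet> w))" by (simp add: inner_sum_right)
    also have "\<dots> = c v * (y v \<bullet> v) + (\<Sum>w\<in>\<omega> - {v}. c w * (y v \<bullet> w))"
      by (rule sum.remove[OF fin v])
    also have "(\<Sum>w\<in>\<omega> - {v}. c w * (y v \<bullet> w)) = (\<Sum>w\<in>\<omega> - {v}. c w)"
      using y[OF v] by (intro sum.cong) auto
    also have "\<dots> = S - c v"
      unfolding S_def using sum.remove[OF fin v, of c] by simp
    finally show ?thesis by (simp add: k_def algebra_simps)
  qed
  have S_nz: "S \<noteq> 0"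
  proof -
    obtain v where "v \<in> \<omega>" "c v \<noteq> 0" using c_nz by blast
    then show ?thesis using S[of v] k_pos[of v] by simp
  qed
  have "1 / (1 + k v) = c v / S" if v: "v \<in> \<omega>" for v
    using S[OF v] S_nz k_pos[OF v] by (auto simp: field_simps)
  then have "(\<Sum>v\<in>\<omega>. 1 / (1 + k v)) = (\<Sum>v\<in>\<omega>. c v / S)" by (intro sum.cong) auto
  also have "\<dots> = 1" using S_nz by (simp add: S_def flip: sum_divide_distrib)
  finally have total: "(\<Sum>v\<in>\<omega>. 1 / (1 + k v)) = 1" .
  show thesis
  proof (rule facets[of k y])
    show "y v \<bullet> v = - k v" for v by (simp add: k_def)
  qed (use k_pos y total in \<open>simp_all\<close>)
qed

lemma dist_power2_unit:
  fixes v w :: "'a::real_inner"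
  assumes "norm v = 1" "norm w = 1"
  shows "(dist v w)\<^sup>2 = 2 - 2 * (v \<bullet> w)"
  using assms by (simp add: dist_norm power2_norm_eq_inner inner_diff inner_commute norm_eq_1)

lemma regular_simplex_verticesI:
  fixes \<omega> :: "(real ^ 'n) set"
  assumes conf: "configuration \<omega>"
    and inner: "\<And>v w. v \<in> \<omega> \<Longrightarrow> w \<in> \<omega> \<Longrightarrow> w \<noteq> v \<Longrightarrow> v \<bullet> w = c"
  shows "regular_simplex_vertices \<omega>"
  unfolding regular_simplex_vertices_def
proof (intro conjI conf exI ballI impI)
  fix v w assume vw: "v \<in> \<omega>" "w \<in> \<omega>" "v \<noteq> w"
  then have "norm v = 1" "norm w = 1"
    using conf by (auto simp: configuration_def)
  then have "(dist v w)\<^sup>2 = 2 - 2 * c"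
    using dist_power2_unit inner vw by metis
  then show "dist v w = sqrt (2 - 2 * c)"
    by (metis real_sqrt_unique zero_le_dist)
qed

text \<open>
  The strict bound \<open>h < 1 / d\<close> is what settles the case of equality. With \<open>y\<close> and \<open>k\<close> as in
  \<open>halfspace_or_facet_normals\<close>, it can only fail if
  \<open>|y v| \<le> d\<close> at every \<open>v\<close> with \<open>k v \<ge> d\<close>; as \<open>k v \<le> |y v|\<close> always, this leaves no room and makes
  all the coordinates \<open>1 / (1 + k v)\<close> equal.
\<close>
lemma separating_direction:
  fixes \<omega> :: "(real ^ 'n) set"
  defines "d \<equiv> real CARD('n)"
  assumes conf: "configuration \<omega>"
  obtains (direction) x v h where "norm x = 1" "v \<in> \<omega>" "0 \<le> h" "h \<le> 1 / d" "x \<bullet> v \<le> - d * h"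
    "\<And>w. w \<in> \<omega> \<Longrightarrow> w \<noteq> v \<Longrightarrow> x \<bullet> w \<le> h"
    "\<not> regular_simplex_vertices \<omega> \<Longrightarrow> h < 1 / d"
proof -
  have card: "card \<omega> = CARD('n) + 1" and unit: "\<And>v. v \<in> \<omega> \<Longrightarrow> norm v = 1"
    using conf by (auto simp: configuration_def)
  have d: "d > 0" by (simp add: d_def)
  have fin: "finite \<omega>"
    using card by (intro card_ge_0_finite) simp
  have "card \<omega> = DIM(real ^ 'n) + 1" using card by simp
  then show thesis
  proof (cases rule: halfspace_or_facet_normals)
    case (halfspace x)
    obtain v where "v \<in> \<omega>" using card by fastforce
    then show thesis using direction[of x v 0] halfspace d by simp
  next
    case (facets y k)
    have k_le: "k v \<le> norm (y v)" if "v \<in> \<omega>" for v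
      using Cauchy_Schwarz_ineq2[of "y v" v] facets(1,2)[OF that] unit[OF that] by simp
    \<comment> \<open>any \<open>v\<close> with barycentric coordinate at most \<open>1 / (d + 1)\<close> yields a direction\<close>
    have *: thesis if v: "v \<in> \<omega>" "k v \<ge> d"
      and strict: "\<not> regular_simplex_vertices \<omega> \<Longrightarrow> norm (y v) > d" for v
    proof (rule direction[of "y v /\<^sub>R norm (y v)" v "1 / norm (y v)"])
      have pos: "norm (y v) > 0" using k_le[OF v(1)] facets(1)[OF v(1)] by linarith
      show "norm (y v /\<^sub>R norm (y v)) = 1" "0 \<le> 1 / norm (y v)" using pos by auto
      show "1 / norm (y v) \<le> 1 / d"
        using d v k_le[OF v(1)] pos by (intro divide_left_mono mult_pos_pos) auto
      show "(y v /\<^sub>R norm (y v)) \<bullet> v \<le> - d * (1 / norm (y v))"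
        using facets(2)[OF v(1)] v(2) pos by (simp add: field_simps)
      show "(y v /\<^sub>R norm (y v)) \<bullet> w \<le> 1 / norm (y v)" if "w \<in> \<omega>" "w \<noteq> v" for w
        using facets(3)[OF v(1) that] by (simp add: divide_inverse)
      show "1 / norm (y v) < 1 / d" if "\<not> regular_simplex_vertices \<omega>"
        using strict[OF that] d by (simp add: frac_less2)
    qed (use v in auto)
    \<comment> \<open>\<open>d + 1\<close> coordinates that are all at least \<open>1 / (d + 1)\<close> and sum to \<open>1\<close>\<close>
    have all_eq: "k v = d" if le: "\<And>w. w \<in> \<omega> \<Longrightarrow> k w \<le> d" and v: "v \<in> \<omega>" for v
    proof -
      have "(\<Sum>w\<in>\<omega>. 1 / (1 + k w) - 1 / (1 + d)) = 1 - (d + 1) / (1 + d)"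
        using facets(4) card by (simp add: sum_subtractf d_def)
      then have "(\<Sum>w\<in>\<omega>. 1 / (1 + k w) - 1 / (1 + d)) = 0" using d by simp
      moreover have "1 / (1 + k w) - 1 / (1 + d) \<ge> 0" if "w \<in> \<omega>" for w
        using le[OF that] facets(1)[OF that] by (simp add: frac_le)
      ultimately have "1 / (1 + k v) - 1 / (1 + d) = 0"
        using v fin by (simp add: sum_nonneg_eq_0_iff)
      then have "1 / (1 + k v) = 1 / (1 + d)" by linarith
      then show ?thesis by simp
    qed
    have "\<exists>v\<in>\<omega>. k v \<ge> d"
    proof (rule ccontr)
      assume neg: "\<not> ?thesis"
      obtain v where "v \<in> \<omega>" using card by fastforce
      then show False using neg all_eq[of v] by force
    qed
    moreover have "regular_simplex_vertices \<omega>"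
      if small: "\<And>v. v \<in> \<omega> \<Longrightarrow> k v \<ge> d \<Longrightarrow> norm (y v) \<le> d"
    proof (rule regular_simplex_verticesI[OF conf])
      have k: "k v = d" if v: "v \<in> \<omega>" for v
        using all_eq small k_le v by (metis linorder_le_cases order_antisym order_trans)
      fix v w assume vw: "v \<in> \<omega>" "w \<in> \<omega>" "w \<noteq> v"
      have "norm (y v) = d" using k[OF vw(1)] small k_le vw(1) by fastforce
      \<comment> \<open>equality in the Cauchy-Schwarz inequality for \<open>y v\<close> and \<open>v\<close>\<close>
      then have "y v \<bullet> y v = d\<^sup>2" by (simp flip: power2_norm_eq_inner)
      moreover have "y v \<bullet> v = - d" "v \<bullet> v = 1"
        using facets(2) k vw(1) unit by (auto simp: norm_eq_1)
      ultimately have "(y v + d *\<^sub>R v) \<bullet> (y v + d *\<^sub>R v) = 0"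
        by (simp add: inner_add inner_commute power2_eq_square)
      then have "y v = - d *\<^sub>R v" by (simp add: add_eq_0_iff2)
      then have "- d * (v \<bullet> w) = 1" using facets(3)[OF vw] by simp
      then show "v \<bullet> w = - 1 / d" using d by (simp add: field_simps)
    qed
    ultimately show thesis using * by (metis not_le)
  qed
qed

section \<open>The regular simplex\<close>

text \<open>
  With \<open>a\<close> the common inner product, pairing a combination \<open>\<Sum>w. c w w\<close> with \<open>v\<close> gives
  \<open>(1 - a) c v + a \<Sum>c\<close>. As \<open>a \<noteq> 1\<close>, every linear dependence has constant coefficients. There is one, as
  there are \<open>d + 1\<close> points, so the points sum to \<open>0\<close>, which determines \<open>a\<close>; and there is no
  other, so any \<open>d\<close> of them form a basis.
\<close>
lemma regular_simplex_inner:
  fixes \<omega> :: "(real ^ 'n) set"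
  assumes reg: "regular_simplex_vertices \<omega>"
  shows regular_simplex_inner_eq:
      "\<And>v w. v \<in> \<omega> \<Longrightarrow> w \<in> \<omega> \<Longrightarrow> w \<noteq> v \<Longrightarrow> v \<bullet> w = - 1 / real CARD('n)"
    and regular_simplex_sum_eq_0: "\<Sum>\<omega> = 0"
    and regular_simplex_span: "span \<omega> = UNIV"
proof -
  define d where "d = real CARD('n)"
  have d: "d > 0" by (simp add: d_def)
  have card: "card \<omega> = CARD('n) + 1" and unit: "\<And>v. v \<in> \<omega> \<Longrightarrow> norm v = 1"
    using reg by (auto simp: regular_simplex_vertices_def configuration_def)
  have fin: "finite \<omega>"
    using card by (intro card_ge_0_finite) simp
  have vv: "v \<bullet> v = 1" if "v \<in> \<omega>" for v using unit[OF that] by (simp add: norm_eq_1)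
  obtain r where r: "\<forall>v\<in>\<omega>. \<forall>w\<in>\<omega>. v \<noteq> w \<longrightarrow> dist v w = r"
    using reg by (auto simp: regular_simplex_vertices_def)
  define a where "a = 1 - r\<^sup>2 / 2"
  have vw: "v \<bullet> w = a" if "v \<in> \<omega>" "w \<in> \<omega>" "w \<noteq> v" for v w
  proof -
    have "(dist v w)\<^sup>2 = 2 - 2 * (v \<bullet> w)" using that by (intro dist_power2_unit unit)
    moreover have "dist v w = r" using that by (intro r[rule_format]) auto
    ultimately have "r\<^sup>2 = 2 - 2 * (v \<bullet> w)" by simp
    then show ?thesis by (simp add: a_def field_simps)
  qed
  have inner_comb: "v \<bullet> (\<Sum>w\<in>\<omega>. c w *\<^sub>R w) = (1 - a) * c v + a * sum c \<omega>"
    if v: "v \<in> \<omega>" for c v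
  proof -
    have "v \<bullet> (\<Sum>w\<in>\<omega>. c w *\<^sub>R w) = (\<Sum>w\<in>\<omega>. c w * (v \<bullet> w))"
      by (simp add: inner_sum_right)
    also have "\<dots> = c v * (v \<bullet> v) + (\<Sum>w\<in>\<omega> - {v}. c w * (v \<bullet> w))"
      by (rule sum.remove[OF fin v])
    also have "(\<Sum>w\<in>\<omega> - {v}. c w * (v \<bullet> w)) = (\<Sum>w\<in>\<omega> - {v}. c w * a)"
      using vw[OF v] by (intro sum.cong) auto
    also have "\<dots> = (sum c \<omega> - c v) * a"
      unfolding sum.remove[OF fin v, of c] by (simp add: sum_distrib_right)
    finally show ?thesis using vv[OF v] by (simp add: algebra_simps)
  qed
  obtain v0 where v0: "v0 \<in> \<omega>" using card by fastforce
  have "card (\<omega> - {v0}) \<noteq> 0" using card v0 fin by simp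
  then have "\<omega> - {v0} \<noteq> {}" by (metis card.empty)
  then obtain w0 where w0: "w0 \<in> \<omega>" "w0 \<noteq> v0" by blast
  have "dist w0 v0 = r" by (rule r[rule_format, OF w0(1) v0 w0(2)])
  moreover have "dist w0 v0 > 0" using w0(2) by simp
  ultimately have "r > 0" by simp
  then have a1: "1 - a > 0" by (simp add: a_def)
  have const: "c v = c w"
    if c: "(\<Sum>u\<in>\<omega>. c u *\<^sub>R u) = 0" and "v \<in> \<omega>" "w \<in> \<omega>" for c v w
  proof -
    have "(1 - a) * c v = (1 - a) * c w"
      using inner_comb[OF that(2), of c] inner_comb[OF that(3), of c] unfolding c inner_zero_right by linarith
    then show ?thesis using a1 by simp
  qed
  have "dependent \<omega>" using card by (intro dependent_biggerset) simp
  then obtain c u where c: "(\<Sum>w\<in>\<omega>. c w *\<^sub>R w) = 0" and u: "u \<in> \<omega>" "c u \<noteq> 0"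
    unfolding dependent_finite[OF fin] by blast
  have "c u *\<^sub>R \<Sum>\<omega> = (\<Sum>w\<in>\<omega>. c w *\<^sub>R w)"
    unfolding scaleR_sum_right
    by (intro sum.cong refl arg_cong2[where f = scaleR] const[OF c u(1)])
  then show sum0: "\<Sum>\<omega> = 0" using c u by simp
  have "0 = 1 + d * a"
    using inner_comb[OF v0, of "\<lambda>_. 1"] sum0 card by (simp add: d_def algebra_simps)
  then have "a = - 1 / d" using d by (simp add: field_simps)
  then show "\<And>v w. v \<in> \<omega> \<Longrightarrow> w \<in> \<omega> \<Longrightarrow> w \<noteq> v \<Longrightarrow> v \<bullet> w = - 1 / real CARD('n)"
    using vw d_def by simp
  have "independent (\<omega> - {v0})"
  proof
    assume "dependent (\<omega> - {v0})"
    then obtain b u where b: "(\<Sum>w\<in>\<omega> - {v0}. b w *\<^sub>R w) = 0" and u: "u \<in> \<omega> - {v0}" "b u \<noteq> 0"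
      using dependent_finite[of "\<omega> - {v0}"] fin by auto
    define b' where "b' w = (if w = v0 then 0 else b w)" for w
    have "(\<Sum>w\<in>\<omega>. b' w *\<^sub>R w) = (\<Sum>w\<in>\<omega> - {v0}. b' w *\<^sub>R w)"
      using sum.remove[OF fin v0, of "\<lambda>w. b' w *\<^sub>R w"] by (simp add: b'_def)
    also have "\<dots> = (\<Sum>w\<in>\<omega> - {v0}. b w *\<^sub>R w)"
      by (intro sum.cong) (auto simp: b'_def)
    also note b
    finally have "b' u = b' v0" using u v0 by (intro const) auto
    then show False using u by (simp add: b'_def)
  qed
  then have "UNIV \<subseteq> span (\<omega> - {v0})"
    using card v0 fin by (intro card_ge_dim_independent) auto
  then show "span \<omega> = UNIV" using span_mono[of "\<omega> - {v0}" \<omega>] by blast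
qed

text \<open>
  The frame operator \<open>x \<mapsto> \<Sum>v. (x \<bullet> v) v\<close> multiplies each vertex by \<open>1 + 1/d\<close>, and the vertices span.
\<close>
lemma regular_simplex_sum_inner_squares:
  fixes \<omega> :: "(real ^ 'n) set"
  assumes reg: "regular_simplex_vertices \<omega>"
  shows "(\<Sum>v\<in>\<omega>. (x \<bullet> v)\<^sup>2) = (1 + 1 / real CARD('n)) * (norm x)\<^sup>2"
proof -
  define d where "d = real CARD('n)"
  have card: "card \<omega> = CARD('n) + 1" and unit: "\<And>v. v \<in> \<omega> \<Longrightarrow> norm v = 1"
    using reg by (auto simp: regular_simplex_vertices_def configuration_def)
  have fin: "finite \<omega>"
    using card by (intro card_ge_0_finite) simp
  have "(\<Sum>v\<in>\<omega>. (x \<bullet> v) *\<^sub>R v) = (1 + 1 / d) *\<^sub>R x"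
  proof (rule linear_eq_on[where B = \<omega> and f = "\<lambda>x. \<Sum>v\<in>\<omega>. (x \<bullet> v) *\<^sub>R v"
        and g = "\<lambda>x. (1 + 1 / d) *\<^sub>R x"])
    show "linear (\<lambda>x. \<Sum>v\<in>\<omega>. (x \<bullet> v) *\<^sub>R v)"
      by (rule linearI) (simp_all add: inner_add_left scaleR_add_left sum.distrib scaleR_sum_right)
    show "linear (\<lambda>x. (1 + 1 / d) *\<^sub>R x)" by (rule linear_scale_self)
    show "x \<in> span \<omega>" using regular_simplex_span[OF reg] by simp
    fix w assume w: "w \<in> \<omega>"
    have "(\<Sum>v\<in>\<omega>. (w \<bullet> v) *\<^sub>R v) = (w \<bullet> w) *\<^sub>R w + (\<Sum>v\<in>\<omega> - {w}. (w \<bullet> v) *\<^sub>R v)"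
      by (rule sum.remove[OF fin w])
    also have "(\<Sum>v\<in>\<omega> - {w}. (w \<bullet> v) *\<^sub>R v) = (\<Sum>v\<in>\<omega> - {w}. (- 1 / d) *\<^sub>R v)"
      using regular_simplex_inner_eq[OF reg w] by (intro sum.cong) (auto simp: d_def)
    also have "\<dots> = (- 1 / d) *\<^sub>R \<Sum>(\<omega> - {w})" by (rule scaleR_sum_right[symmetric])
    also have "\<Sum>(\<omega> - {w}) = \<Sum>\<omega> - w"
      using sum.remove[OF fin w, of "\<lambda>v. v"] by simp
    finally show "(\<Sum>v\<in>\<omega>. (w \<bullet> v) *\<^sub>R v) = (1 + 1 / d) *\<^sub>R w"
      using regular_simplex_sum_eq_0[OF reg] unit[OF w]
      by (simp add: norm_eq_1 scaleR_add_left)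
  qed
  then have "x \<bullet> (\<Sum>v\<in>\<omega>. (x \<bullet> v) *\<^sub>R v) = (1 + 1 / d) * (x \<bullet> x)" by simp
  then show ?thesis
    by (simp add: inner_sum_right power2_eq_square d_def flip: power2_norm_eq_inner)
qed

section \<open>Consequences of convexity of a function and concavity of its derivative\<close>

text \<open>
  The error \<open>e\<close> of Hermite interpolation with a double node at \<open>a\<close> and a simple node at \<open>b\<close> is
  analysed without a third derivative. Its derivative \<open>e'\<close> is concave and vanishes at \<open>a\<close>, and by
  Rolle also at some \<open>c\<close> between the nodes. So \<open>e'\<close> is nonnegative on \<open>[a, c]\<close> and nonpositive
  outside: \<open>e\<close> decreases to \<open>e a = 0\<close>, increases up to \<open>c\<close>, and decreases to \<open>e b = 0\<close>.
\<close>
lemma hermite_quadratic_minorant: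
  fixes F :: "real \<Rightarrow> real"
  assumes "l < a" "a < b"
    and cont: "continuous_on {l<..b} F"
    and diff: "\<And>t. t \<in> {l<..<b} \<Longrightarrow> F differentiable (at t)"
    and conc: "concave_on {l<..<b} (deriv F)"
  obtains D C where "\<And>t. t \<in> {l<..b} \<Longrightarrow> F a + D * (t - a) + C * (t - a)\<^sup>2 \<le> F t"
    "F a + D * (b - a) + C * (b - a)\<^sup>2 = F b"
proof -
  define D where "D = deriv F a"
  define C where "C = (F b - F a - D * (b - a)) / (b - a)\<^sup>2"
  define e where "e t = F t - (F a + D * (t - a) + C * (t - a)\<^sup>2)" for t
  define e' where "e' t = deriv F t - (D + 2 * C * (t - a))" for t
  have qb: "F a + D * (b - a) + C * (b - a)\<^sup>2 = F b"
    using \<open>a < b\<close> by (simp add: C_def)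
  have ea: "e a = 0" and eb: "e b = 0" using qb by (simp_all add: e_def)
  have de: "(e has_real_derivative e' t) (at t)" if "t \<in> {l<..<b}" for t
  proof -
    have "(F has_real_derivative deriv F t) (at t)"
      using diff[OF that] by (simp add: DERIV_deriv_iff_real_differentiable)
    then show ?thesis
      unfolding e_def e'_def by (auto intro!: derivative_eq_intros)
  qed
  have ce: "continuous_on {s..t} e" if "l < s" "t \<le> b" for s t
    unfolding e_def using that
    by (intro continuous_intros continuous_on_subset[OF cont]) auto
  have conc': "(1 - u) * e' s + u * e' t \<le> e' ((1 - u) * s + u * t)"
    if "0 \<le> u" "u \<le> 1" "s \<in> {l<..<b}" "t \<in> {l<..<b}" for s t u
    using concave_onD[OF conc that] by (simp add: e'_def algebra_simps)
  have e'a: "e' a = 0" by (simp add: e'_def D_def)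
  obtain c where c: "a < c" "c < b" "e' c = 0"
  proof -
    obtain z where z: "a < z" "z < b" "(*) (e' z) = (\<lambda>v. 0)"
      using Rolle_deriv[of a b e "\<lambda>t. (*) (e' t)"] ea eb ce[of a b] de \<open>l < a\<close> \<open>a < b\<close>
      by (auto simp: has_field_derivative_def)
    then show thesis using that[of z] fun_cong[OF z(3), of 1] by simp
  qed
  have mid: "e' t \<ge> 0" if "a \<le> t" "t \<le> c" for t
  proof -
    define u where "u = (t - a) / (c - a)"
    have "(1 - u) * a + u * c = a + u * (c - a)" by (simp add: algebra_simps)
    also have "\<dots> = t" using c by (simp add: u_def)
    finally show ?thesis
      using conc'[of u a c] that c e'a \<open>l < a\<close> by (simp add: u_def)
  qed
  have left: "e' t \<le> 0" if "l < t" "t < a" for t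
  proof -
    define u where "u = (a - t) / (c - t)"
    have u: "0 \<le> u" "u < 1" using that c by (auto simp: u_def)
    have "(1 - u) * t + u * c = t + u * (c - t)" by (simp add: algebra_simps)
    also have "\<dots> = a" using c that by (simp add: u_def)
    finally have "(1 - u) * e' t \<le> 0"
      using conc'[of u t c] that c e'a u by simp
    then show ?thesis using u by (simp add: mult_le_0_iff)
  qed
  have right: "e' t \<le> 0" if "c < t" "t < b" for t
  proof -
    define u where "u = (c - a) / (t - a)"
    have u: "0 < u" "u \<le> 1" using that c by (auto simp: u_def)
    have "(1 - u) * a + u * t = a + u * (t - a)" by (simp add: algebra_simps)
    also have "\<dots> = c" using c that by (simp add: u_def)
    finally have "u * e' t \<le> 0"
      using conc'[of u a t] that c e'a u \<open>l < a\<close> by simp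
    then show ?thesis using u by (simp add: mult_le_0_iff)
  qed
  have "e t \<ge> 0" if t: "t \<in> {l<..b}" for t
  proof -
    consider "t \<le> a" | "a \<le> t" "t \<le> c" | "c \<le> t" by linarith
    then show ?thesis
    proof cases
      case 1
      then have "e a \<le> e t"
        using t c by (intro DERIV_nonpos_imp_decreasing_open[OF 1] ce) (force intro!: de left)+
      then show ?thesis using ea by simp
    next
      case 2
      then have "e a \<le> e t"
        using t c \<open>l < a\<close> by (intro DERIV_nonneg_imp_increasing_open[OF 2(1)] ce) (force intro!: de mid)+
      then show ?thesis using ea by simp
    next
      case 3
      then have "e b \<le> e t"
        using t c \<open>l < a\<close> by (intro DERIV_nonpos_imp_decreasing_open[of t b] ce) (force intro!: de right)+
      then show ?thesis using eb by simp
    qed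
  qed
  then show thesis using that[OF _ qb] by (simp add: e_def)
qed

text \<open>
  Both arguments lie between \<open>a\<close> and \<open>4\<close>, so each value is bounded by the chord of \<open>F\<close> over \<open>[a, 4]\<close>.
  The chord is affine and the weighted mean of the arguments is the same as that of \<open>a\<close> and \<open>4\<close>, so the
  two bounds add up to the right-hand side.
\<close>
lemma weighted_values_le:
  fixes F :: "real \<Rightarrow> real" and d h :: real
  assumes d: "d \<ge> 1" and h: "0 \<le> h" "h \<le> 1 / d"
    and a: "a = 2 - 2 / d" "a \<in> S" "4 \<in> S"
  shows weighted_values_le_convex:
      "convex_on S F \<Longrightarrow> d * F (2 - 2 * h) + F (2 + 2 * d * h) \<le> d * F a + F 4"
    and weighted_values_less_strictly_convex:
      "strictly_convex_on S F \<Longrightarrow> h < 1 / d \<Longrightarrow>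
        d * F (2 - 2 * h) + F (2 + 2 * d * h) < d * F a + F 4"
proof -
  have hd: "0 \<le> d * h" "d * h \<le> 1" using h d by (auto simp: field_simps)
  \<comment> \<open>positions of the two arguments on the segment from \<open>a\<close> to \<open>4\<close>\<close>
  define p where "p = (1 - d * h) / (d + 1)"
  define q where "q = (d\<^sup>2 * h + 1) / (d + 1)"
  have "d * p + q = (d * (1 - d * h) + (d\<^sup>2 * h + 1)) / (d + 1)"
    by (simp add: p_def q_def add_divide_distrib)
  also have "\<dots> = 1" using d by (simp add: algebra_simps power2_eq_square)
  finally have pq: "d * p + q = 1" .
  have p: "0 \<le> p" "p < 1" using hd d by (auto simp: p_def)
  have "0 < q" using h d by (simp add: q_def add_nonneg_pos)
  moreover have "0 \<le> d * p" using d p by simp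
  ultimately have q: "0 < q" "q \<le> 1" using pq by linarith+
  have chord: "(1 - u) * a + u * 4 = 2 - 2 / d + 2 * (u * (d + 1)) / d" for u
    using d by (simp add: a(1) field_simps)
  have "p * (d + 1) = 1 - d * h" "q * (d + 1) = d\<^sup>2 * h + 1"
    using d by (simp_all add: p_def q_def)
  note chord = chord[of p, unfolded this(1)] chord[of q, unfolded this(2)]
  have xp: "2 - 2 * h = (1 - p) * a + p * 4"
    using d unfolding chord by (simp add: field_simps)
  have xq: "2 + 2 * d * h = (1 - q) * a + q * 4"
    using d unfolding chord by (simp add: field_simps power2_eq_square)
  have total: "d * ((1 - p) * F a + p * F 4) + ((1 - q) * F a + q * F 4) = d * F a + F 4"
  proof -
    have "d * ((1 - p) * F a + p * F 4) + ((1 - q) * F a + q * F 4)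
        = d * F a + F a + (d * p + q) * (F 4 - F a)"
      by (simp add: algebra_simps)
    then show ?thesis by (simp add: pq)
  qed
  show "d * F (2 - 2 * h) + F (2 + 2 * d * h) \<le> d * F a + F 4" if cv: "convex_on S F"
  proof -
    have "F (2 - 2 * h) \<le> (1 - p) * F a + p * F 4"
      using convex_onD[OF cv, of p a 4] p a unfolding xp by simp
    moreover have "F (2 + 2 * d * h) \<le> (1 - q) * F a + q * F 4"
      using convex_onD[OF cv, of q a 4] q a unfolding xq by simp
    ultimately show ?thesis
      using d by (subst total[symmetric]) (intro add_mono mult_left_mono, auto)
  qed
  show "d * F (2 - 2 * h) + F (2 + 2 * d * h) < d * F a + F 4"
    if cv: "strictly_convex_on S F" and h1: "h < 1 / d"
  proof -
    have "d * h < 1" using h1 d by (simp add: field_simps)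
    then have p0: "p > 0" using d by (simp add: p_def)
    then have q1: "q < 1" using pq d by (smt (verit) mult_pos_pos)
    have ne: "a \<noteq> 4" using d by (simp add: a(1) field_simps)
    have strict: "F ((1 - u) * a + u * 4) < (1 - u) * F a + u * F 4" if "0 < u" "u < 1" for u
      using cv a ne that unfolding strictly_convex_on_def by simp
    have "F (2 - 2 * h) < (1 - p) * F a + p * F 4"
      unfolding xp by (rule strict[OF p0 p(2)])
    moreover have "F (2 + 2 * d * h) < (1 - q) * F a + q * F 4"
      unfolding xq by (rule strict[OF q(1) q1])
    ultimately show ?thesis
      using d by (subst total[symmetric]) (intro add_strict_mono mult_strict_left_mono, auto)
  qed
qed

section \<open>Potentials and their minima\<close>

lemma norm_diff_power2_unit:
  fixes x v :: "'a::real_inner"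
  assumes "norm x = 1" "norm v = 1"
  shows "(norm (x - v))\<^sup>2 = 2 - 2 * (x \<bullet> v)" "(norm (x - v))\<^sup>2 \<in> {0..4}"
proof -
  show eq: "(norm (x - v))\<^sup>2 = 2 - 2 * (x \<bullet> v)"
    using dist_power2_unit[OF assms] by (simp add: dist_norm)
  show "(norm (x - v))\<^sup>2 \<in> {0..4}"
    using Cauchy_Schwarz_ineq2[of x v] assms unfolding eq by (auto simp: abs_le_iff)
qed

lemma admissible_potential_eq_ereal:
  assumes "admissible_potential f" "t \<in> {0<..4}"
  shows "f t = ereal (real_of_ereal (f t))"
proof -
  have "\<bar>f t\<bar> \<noteq> \<infinity>"
    using assms by (auto simp: admissible_potential_def)
  then show ?thesis by (simp add: ereal_real)
qed

text \<open>
  A convex function can only jump at an endpoint of its domain, and only upwards. At the right endpoint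
  \<open>b\<close> monotonicity rules this out.
\<close>
lemma continuous_on_antimono_convex:
  fixes F :: "real \<Rightarrow> real"
  assumes anti: "antimono_on {l<..b} F" and cv: "convex_on {l<..b} F"
  shows "continuous_on {l<..b} F"
proof -
  have cont: "continuous_on {l<..<b} F"
    by (rule convex_on_continuous[OF _ convex_on_subset[OF cv]]) auto
  have left: "(F \<longlongrightarrow> F b) (at b within {l<..b})" if "l < b"
  proof -
    define m where "m = (l + b) / 2"
    have m: "l < m" "m < b" using that by (auto simp: m_def)
    have lim: "((\<lambda>t. F m + (t - m) / (b - m) * (F b - F m)) \<longlongrightarrow> F b) (at b within {l<..b})"
      using m by (auto intro!: tendsto_eq_intros)
    have near: "eventually (\<lambda>t. t \<in> {l<..b} \<and> m < t) (at b within {l<..b})"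
      by (intro eventually_conj order_tendstoD(1)[OF tendsto_ident_at m(2)])
         (simp add: eventually_at_filter)
    show ?thesis
    proof (rule tendsto_sandwich[OF _ _ tendsto_const lim])
      show "eventually (\<lambda>t. F b \<le> F t) (at b within {l<..b})"
        using near by eventually_elim (use anti m in \<open>auto simp: monotone_on_def\<close>)
      show "eventually (\<lambda>t. F t \<le> F m + (t - m) / (b - m) * (F b - F m)) (at b within {l<..b})"
        using near
      proof eventually_elim
        case (elim t)
        define u where "u = (t - m) / (b - m)"
        have "(1 - u) * m + u * b = m + u * (b - m)" by (simp add: algebra_simps)
        also have "\<dots> = t" using m by (simp add: u_def)
        finally have "F t \<le> (1 - u) * F m + u * F b"
          using convex_onD[OF cv, of u m b] elim m by (simp add: u_def)
        then show ?case by (simp add: algebra_simps flip: u_def)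
      qed
    qed
  qed
  show ?thesis
    unfolding continuous_on_def
  proof
    fix t assume t: "t \<in> {l<..b}"
    show "(F \<longlongrightarrow> F t) (at t within {l<..b})"
    proof (cases "t = b")
      case True
      then show ?thesis using left t by simp
    next
      case False
      then have "isCont F t"
        using cont t by (simp add: continuous_on_eq_continuous_at)
      then show ?thesis
        using continuous_at_imp_continuous_at_within continuous_within by blast
    qed
  qed
qed

lemma admissible_potential_continuous_real:
  assumes adm: "admissible_potential f"
  shows "continuous_on {0<..4} (real_of_ereal \<circ> f)"
proof (rule continuous_on_antimono_convex)
  show "convex_on {0<..4} (real_of_ereal \<circ> f)"
    using adm by (simp add: admissible_potential_def)
  have "antimono_on {0<..4} f" using adm by (simp add: admissible_potential_def)
  then show "antimono_on {0<..4} (real_of_ereal \<circ> f)"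
    unfolding monotone_on_def o_def
    by (metis admissible_potential_eq_ereal[OF adm] ereal_less_eq(3))
qed

lemma admissible_potential_continuous:
  assumes adm: "admissible_potential f"
  shows "continuous_on {0..4} f"
  unfolding continuous_on_def
proof
  fix t :: real assume t: "t \<in> {0..4}"
  show "(f \<longlongrightarrow> f t) (at t within {0..4})"
  proof (cases "t = 0")
    case True
    then show ?thesis
      using adm by (simp add: admissible_potential_def at_within_Icc_at_right)
  next
    case False
    have "continuous_on {0<..4} (\<lambda>t. ereal ((real_of_ereal \<circ> f) t))"
      by (intro continuous_on_ereal admissible_potential_continuous_real[OF adm])
    then have "continuous_on {0<..4} f"
      by (rule continuous_on_eq) (use admissible_potential_eq_ereal[OF adm] in auto)
    then have "(f \<longlongrightarrow> f t) (at t within {0<..4})"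
      using t False by (simp add: continuous_on_def)
    also have "at t within {0<..4} = at t within {0..4}"
      by (rule at_within_nhd[of t "{0<..}"]) (use t False in auto)
    finally show ?thesis .
  qed
qed

lemma tendsto_sum_ereal_not_MInf:
  fixes g :: "'a \<Rightarrow> 'b \<Rightarrow> ereal"
  assumes "finite S"
    and "\<And>i. i \<in> S \<Longrightarrow> (g i \<longlongrightarrow> a i) F"
    and "\<And>i. i \<in> S \<Longrightarrow> a i \<noteq> -\<infinity>"
  shows "((\<lambda>x. \<Sum>i\<in>S. g i x) \<longlongrightarrow> (\<Sum>i\<in>S. a i)) F"
  using assms
proof (induction S rule: finite_induct)
  case (insert i S)
  have "(\<Sum>i\<in>T. a i) \<noteq> -\<infinity>" if "finite T" "\<forall>i\<in>T. a i \<noteq> -\<infinity>" for T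
    using that by (induction T rule: finite_induct) (auto simp: ereal_MInfty_eq_plus)
  then have "(\<Sum>i\<in>S. a i) \<noteq> -\<infinity>" using insert by blast
  then show ?case
    using insert by (simp, intro tendsto_add_ereal_general) auto
qed simp

text \<open>
  Continuity of \<open>f\<close> up to the possibly infinite value \<open>f 0\<close> makes every potential continuous on the
  compact sphere, so the least value that defines the polarization exists.
\<close>
lemma polarization_attained:
  fixes \<omega> :: "(real ^ 'n) set"
  assumes adm: "admissible_potential f" and conf: "configuration \<omega>"
  obtains x where "norm x = 1" "polarization f \<omega> (sphere 0 1) = potential f \<omega> x"
    "\<And>y. norm y = 1 \<Longrightarrow> potential f \<omega> x \<le> potential f \<omega> y"
proof -
  have unit: "\<And>v. v \<in> \<omega> \<Longrightarrow> norm v = 1" and fin: "finite \<omega>" and ne: "\<omega> \<noteq> {}"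
    using conf by (auto simp: configuration_def intro!: card_ge_0_finite)
  have range: "(norm (x - v))\<^sup>2 \<in> {0..4}" if "x \<in> sphere 0 1" "v \<in> \<omega>" for x v
    using norm_diff_power2_unit(2)[of x v] that unit by simp
  have "continuous_on (sphere 0 1) (potential f \<omega>)"
    unfolding continuous_on_def
  proof
    fix x :: "real ^ 'n" assume x: "x \<in> sphere 0 1"
    have "((\<lambda>x. f ((norm (x - v))\<^sup>2)) \<longlongrightarrow> f ((norm (x - v))\<^sup>2)) (at x within sphere 0 1)"
      if v: "v \<in> \<omega>" for v
    proof -
      have "continuous_on (sphere 0 1) (\<lambda>x. f ((norm (x - v))\<^sup>2))"
        by (rule continuous_on_compose2[OF admissible_potential_continuous[OF adm]])
           (use range[OF _ v] in \<open>auto intro!: continuous_intros\<close>)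
      then show ?thesis using x by (simp add: continuous_on_def)
    qed
    then show "(potential f \<omega> \<longlongrightarrow> potential f \<omega> x) (at x within sphere 0 1)"
      unfolding potential_def using fin range[OF x] adm
      by (intro tendsto_sum_ereal_not_MInf) (auto simp: admissible_potential_def)
  qed
  moreover have "sphere (0::real ^ 'n) 1 \<noteq> {}" using ne unit by force
  ultimately obtain x where x: "x \<in> sphere 0 1" "\<forall>y\<in>sphere 0 1. potential f \<omega> x \<le> potential f \<omega> y"
    using continuous_attains_inf[OF compact_sphere] by blast
  then have "polarization f \<omega> (sphere 0 1) = potential f \<omega> x"
    unfolding polarization_def by (intro Least_equality) auto
  then show thesis using that[of x] x by auto
qed

lemma polarization_le_potential:
  fixes \<omega> :: "(real ^ 'n) set"
  assumes "admissible_potential f" "configuration \<omega>" "norm x = 1"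
  shows "polarization f \<omega> (sphere 0 1) \<le> potential f \<omega> x"
  using polarization_attained[OF assms(1,2)] assms(3) by metis

lemma potential_le_of_separation:
  fixes \<omega> :: "(real ^ 'n) set"
  defines "d \<equiv> real CARD('n)"
  assumes d2: "CARD('n) \<ge> 2" and adm: "admissible_potential f" and conf: "configuration \<omega>"
    and x: "norm x = 1" and v: "v \<in> \<omega>" and h: "0 \<le> h" "h \<le> 1 / d"
    and xv: "x \<bullet> v \<le> - d * h" and xw: "\<And>w. w \<in> \<omega> \<Longrightarrow> w \<noteq> v \<Longrightarrow> x \<bullet> w \<le> h"
  shows "potential f \<omega> x \<le> ereal (d * (real_of_ereal \<circ> f) (2 - 2 * h) + (real_of_ereal \<circ> f) (2 + 2 * d * h))"
proof -
  have card: "card \<omega> = CARD('n) + 1" and unit: "\<And>v. v \<in> \<omega> \<Longrightarrow> norm v = 1"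
    using conf by (auto simp: configuration_def)
  have fin: "finite \<omega>" using card by (intro card_ge_0_finite) simp
  have d: "d \<ge> 2" using d2 by (simp add: d_def)
  have "1 / d \<le> 1 / 2" using d by (intro divide_left_mono) auto
  then have h1: "h \<le> 1 / 2" using h by linarith
  have dh: "0 \<le> d * h" "d * h \<le> 1" using h d by (auto simp: field_simps)
  have anti: "f s \<le> f t" if "0 < t" "t \<le> s" "s \<le> 4" for s t
    using adm that by (auto simp: admissible_potential_def monotone_on_def)
  have dist: "(norm (x - w))\<^sup>2 = 2 - 2 * (x \<bullet> w)" "(norm (x - w))\<^sup>2 \<le> 4" if "w \<in> \<omega>" for w
    using norm_diff_power2_unit[OF x unit[OF that]] by auto
  have "potential f \<omega> x = f ((norm (x - v))\<^sup>2) + (\<Sum>w\<in>\<omega> - {v}. f ((norm (x - w))\<^sup>2))"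
    unfolding potential_def by (rule sum.remove[OF fin v])
  also have "\<dots> \<le> f (2 + 2 * d * h) + (\<Sum>w\<in>\<omega> - {v}. f (2 - 2 * h))"
  proof (intro add_mono sum_mono anti)
    show "2 + 2 * d * h \<le> (norm (x - v))\<^sup>2" using dist[OF v] xv by simp
    show "2 - 2 * h \<le> (norm (x - w))\<^sup>2" if "w \<in> \<omega> - {v}" for w
      using dist[of w] xw[of w] that by simp
  qed (use dist[OF v] dist(2) h1 dh in auto)
  also have "f (2 + 2 * d * h) = ereal ((real_of_ereal \<circ> f) (2 + 2 * d * h))"
    using admissible_potential_eq_ereal[OF adm, of "2 + 2 * d * h"] dh by simp
  also have "f (2 - 2 * h) = ereal ((real_of_ereal \<circ> f) (2 - 2 * h))"
    using admissible_potential_eq_ereal[OF adm, of "2 - 2 * h"] h h1 by simp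
  also have "(\<Sum>w\<in>\<omega> - {v}. ereal ((real_of_ereal \<circ> f) (2 - 2 * h))) = ereal (d * (real_of_ereal \<circ> f) (2 - 2 * h))"
    using card fin v by (simp add: d_def)
  finally show ?thesis by (simp add: add.commute)
qed

lemma polarization_regular_simplex:
  fixes \<omega> :: "(real ^ 'n) set"
  defines "d \<equiv> real CARD('n)"
  assumes d2: "CARD('n) \<ge> 2" and adm: "admissible_potential f"
    and reg: "regular_simplex_vertices \<omega>"
  shows "polarization f \<omega> (sphere 0 1)
    = ereal (d * (real_of_ereal \<circ> f) (2 - 2 / d) + (real_of_ereal \<circ> f) 4)"
proof (rule antisym)
  define F where "F = real_of_ereal \<circ> f"
  define a where "a = 2 - 2 / d"
  have conf: "configuration \<omega>" using reg by (simp add: regular_simplex_vertices_def)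
  then have card: "card \<omega> = CARD('n) + 1" and unit: "\<And>v. v \<in> \<omega> \<Longrightarrow> norm v = 1"
    by (auto simp: configuration_def)
  have fin: "finite \<omega>" using card by (intro card_ge_0_finite) simp
  have d: "d \<ge> 2" using d2 by (simp add: d_def)
  obtain v where v: "v \<in> \<omega>" using card by fastforce
  have "- v \<bullet> w \<le> 1 / d" if "w \<in> \<omega>" "w \<noteq> v" for w
    using regular_simplex_inner_eq[OF reg v that] by (simp add: d_def)
  moreover have "- v \<bullet> v \<le> - d * (1 / d)"
    using unit[OF v] d by (simp add: norm_eq_1)
  ultimately have "potential f \<omega> (- v) \<le>
      ereal (d * (real_of_ereal \<circ> f) (2 - 2 * (1 / d)) + (real_of_ereal \<circ> f) (2 + 2 * d * (1 / d)))"
    using potential_le_of_separation[OF d2 adm conf _ v, of "- v" "1 / d"] unit[OF v] d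
    by (simp add: d_def)
  then show "polarization f \<omega> (sphere 0 1)
      \<le> ereal (d * (real_of_ereal \<circ> f) (2 - 2 / d) + (real_of_ereal \<circ> f) 4)"
    using polarization_le_potential[OF adm conf, of "- v"] unit[OF v] d by simp
  have a: "0 < a" "a < 4" using d by (auto simp: a_def field_simps)
  obtain D C where minor: "\<And>t. t \<in> {0<..4} \<Longrightarrow> F a + D * (t - a) + C * (t - a)\<^sup>2 \<le> F t"
    and touch: "F a + D * (4 - a) + C * (4 - a)\<^sup>2 = F 4"
    by (rule hermite_quadratic_minorant[OF a, of F])
      (use adm admissible_potential_continuous_real[OF adm] in \<open>auto simp: admissible_potential_def F_def\<close>)
  define q where "q t = F a + D * (t - a) + C * (t - a)\<^sup>2" for t
  have q_le: "ereal (q t) \<le> f t" if t: "t \<in> {0<..4}" for t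
    using minor[OF t] admissible_potential_eq_ereal[OF adm t] unfolding q_def F_def
    by (metis comp_apply ereal_less_eq(3))
  have "ereal (q 0) \<le> f 0"
  proof (rule tendsto_le)
    show "(f \<longlongrightarrow> f 0) (at_right 0)" using adm by (simp add: admissible_potential_def)
    show "((\<lambda>t. ereal (q t)) \<longlongrightarrow> ereal (q 0)) (at_right 0)"
      unfolding q_def by (intro tendsto_intros)
    show "eventually (\<lambda>t. ereal (q t) \<le> f t) (at_right 0)"
      unfolding eventually_at_right_field using q_le by (intro exI[of _ 4]) auto
  qed simp
  with q_le have q_le0: "ereal (q t) \<le> f t" if "t \<in> {0..4}" for t
    using that by (cases "t = 0") auto
  obtain x where x: "norm x = 1" "polarization f \<omega> (sphere 0 1) = potential f \<omega> x"
    by (rule polarization_attained[OF adm conf])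
  have "(\<Sum>v\<in>\<omega>. x \<bullet> v) = 0"
    using regular_simplex_sum_eq_0[OF reg] by (simp flip: inner_sum_right)
  moreover have "(\<Sum>v\<in>\<omega>. (x \<bullet> v)\<^sup>2) = 1 + 1 / d"
    using regular_simplex_sum_inner_squares[OF reg, of x] x by (simp add: d_def)
  moreover have "q (2 - 2 * t) = F a + 2 * D / d + 4 * C / d\<^sup>2 - (2 * D + 8 * C / d) * t + 4 * C * t\<^sup>2" for t
    using d by (simp add: q_def a_def field_simps power2_eq_square)
  ultimately have "(\<Sum>v\<in>\<omega>. q (2 - 2 * (x \<bullet> v)))
      = (d + 1) * (F a + 2 * D / d + 4 * C / d\<^sup>2) + 4 * C * (1 + 1 / d)"
    using card by (simp add: sum.distrib sum_subtractf d_def flip: sum_distrib_left)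
  also have "\<dots> = d * F a + (F a + D * (4 - a) + C * (4 - a)\<^sup>2)"
    using d by (simp add: a_def field_simps power2_eq_square)
  finally have total: "(\<Sum>v\<in>\<omega>. q (2 - 2 * (x \<bullet> v))) = d * F a + F 4" by (simp only: touch)
  have "ereal (q (2 - 2 * (x \<bullet> v))) \<le> f ((norm (x - v))\<^sup>2)" if "v \<in> \<omega>" for v
    using norm_diff_power2_unit[OF x(1) unit[OF that]] q_le0 by metis
  then have "(\<Sum>v\<in>\<omega>. ereal (q (2 - 2 * (x \<bullet> v)))) \<le> potential f \<omega> x"
    unfolding potential_def by (rule sum_mono)
  then show "ereal (d * (real_of_ereal \<circ> f) (2 - 2 / d) + (real_of_ereal \<circ> f) 4)
      \<le> polarization f \<omega> (sphere 0 1)"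
    using total x(2) by (simp add: F_def a_def)
qed

lemma polarization_le_simplex_value:
  fixes \<omega> :: "(real ^ 'n) set"
  defines "d \<equiv> real CARD('n)"
  assumes d2: "CARD('n) \<ge> 2" and adm: "admissible_potential f" and conf: "configuration \<omega>"
  defines "M \<equiv> ereal (d * (real_of_ereal \<circ> f) (2 - 2 / d) + (real_of_ereal \<circ> f) 4)"
  shows polarization_le: "polarization f \<omega> (sphere 0 1) \<le> M"
    and polarization_less: "strictly_convex_on {0<..4} (real_of_ereal \<circ> f) \<Longrightarrow>
      \<not> regular_simplex_vertices \<omega> \<Longrightarrow> polarization f \<omega> (sphere 0 1) < M"
proof -
  obtain x v h where x: "norm x = 1" and v: "v \<in> \<omega>" and h: "0 \<le> h" "h \<le> 1 / d"
    and sep: "x \<bullet> v \<le> - d * h" "\<And>w. w \<in> \<omega> \<Longrightarrow> w \<noteq> v \<Longrightarrow> x \<bullet> w \<le> h"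
    and strict: "\<not> regular_simplex_vertices \<omega> \<Longrightarrow> h < 1 / d"
    unfolding d_def by (rule separating_direction[OF conf]) blast
  have d: "d \<ge> 2" using d2 by (simp add: d_def)
  then have a: "2 - 2 / d \<in> {0<..4::real}" "4 \<in> {0<..4::real}" and d1: "d \<ge> 1"
    by (auto simp: field_simps)
  have le: "polarization f \<omega> (sphere 0 1)
      \<le> ereal (d * (real_of_ereal \<circ> f) (2 - 2 * h) + (real_of_ereal \<circ> f) (2 + 2 * d * h))"
    using polarization_le_potential[OF adm conf x]
      potential_le_of_separation[OF d2 adm conf x v, of h] h sep unfolding d_def
    by (meson order_trans)
  have "convex_on {0<..4} (real_of_ereal \<circ> f)" using adm by (simp add: admissible_potential_def)
  then show "polarization f \<omega> (sphere 0 1) \<le> M"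
    using le weighted_values_le_convex[OF d1 h refl a, of "real_of_ereal \<circ> f"]
    unfolding M_def by (meson ereal_less_eq(3) order_trans)
  show "polarization f \<omega> (sphere 0 1) < M"
    if sc: "strictly_convex_on {0<..4} (real_of_ereal \<circ> f)" and nr: "\<not> regular_simplex_vertices \<omega>"
    using le weighted_values_less_strictly_convex[OF d1 h refl a sc strict[OF nr]]
    unfolding M_def by (meson less_ereal.simps(1) order.strict_trans1)
qed

section \<open>Optimality of the regular simplex\<close>

theorem theorem2p1:
  fixes f :: "real \<Rightarrow> ereal" and \<omega>s :: "(real ^ 'n) set"
  assumes "CARD('n) \<ge> 2"
    and "admissible_potential f"
    and "regular_simplex_vertices \<omega>s"
  shows "(\<forall>\<omega> :: (real ^ 'n) set. configuration \<omega> \<longrightarrow>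
            polarization f \<omega> (sphere 0 1) \<le> polarization f \<omega>s (sphere 0 1)) \<and>
         max_polarization f (sphere (0 :: real ^ 'n) 1) = polarization f \<omega>s (sphere 0 1) \<and>
         polarization f \<omega>s (sphere 0 1) =
           f 4 + ereal (real CARD('n)) * f (2 - 2 / real CARD('n)) \<and>
         (strictly_convex_on {0<..4} (real_of_ereal \<circ> f) \<longrightarrow>
           (\<forall>\<omega> :: (real ^ 'n) set. configuration \<omega> \<longrightarrow>
             (polarization f \<omega> (sphere 0 1) = polarization f \<omega>s (sphere 0 1) \<longleftrightarrow>
              regular_simplex_vertices \<omega>)))"
proof -
  define d where "d = real CARD('n)"
  define M where "M = ereal (d * (real_of_ereal \<circ> f) (2 - 2 / d) + (real_of_ereal \<circ> f) 4)"
  have regular: "polarization f \<omega> (sphere 0 1) = M"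
    if "regular_simplex_vertices \<omega>" for \<omega> :: "(real ^ 'n) set"
    using polarization_regular_simplex[OF assms(1,2) that] by (simp add: M_def d_def)
  have le: "polarization f \<omega> (sphere 0 1) \<le> M" if "configuration \<omega>" for \<omega> :: "(real ^ 'n) set"
    using polarization_le[OF assms(1,2) that] by (simp add: M_def d_def)
  have less: "polarization f \<omega> (sphere 0 1) < M"
    if "strictly_convex_on {0<..4} (real_of_ereal \<circ> f)" "configuration \<omega>"
      "\<not> regular_simplex_vertices \<omega>" for \<omega> :: "(real ^ 'n) set"
    using polarization_less[OF assms(1,2) that(2,1,3)] by (simp add: M_def d_def)
  have "max_polarization f (sphere (0 :: real ^ 'n) 1) = M"
    unfolding max_polarization_def
  proof (rule antisym)
    show "(SUP \<omega>\<in>{\<omega>. \<omega> \<subseteq> sphere (0 :: real ^ 'n) 1 \<and> card \<omega> = CARD('n) + 1}.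
        polarization f \<omega> (sphere 0 1)) \<le> M"
      by (intro SUP_least le) (simp add: configuration_def)
    show "M \<le> (SUP \<omega>\<in>{\<omega>. \<omega> \<subseteq> sphere (0 :: real ^ 'n) 1 \<and> card \<omega> = CARD('n) + 1}.
        polarization f \<omega> (sphere 0 1))"
      using assms(3) regular[OF assms(3)]
      by (intro SUP_upper2[of \<omega>s]) (auto simp: regular_simplex_vertices_def configuration_def)
  qed
  moreover have "M = f 4 + ereal d * f (2 - 2 / d)"
  proof -
    have "d \<ge> 2" using assms(1) by (simp add: d_def)
    then have "2 - 2 / d \<in> {0<..4}" by (auto simp: field_simps)
    from admissible_potential_eq_ereal[OF assms(2) this]
      admissible_potential_eq_ereal[OF assms(2), of 4]
    obtain r s where "f (2 - 2 / d) = ereal r" "f 4 = ereal s" by fastforce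
    then show ?thesis by (simp add: M_def)
  qed
  ultimately show ?thesis
    using regular le less regular[OF assms(3)] by (auto simp: d_def dest: less_imp_neq)
qed

end
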